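(* Let $A$ and $B$ be two skew braces such that $A/\mathrm{Ann}_n(A)$ is brace isomorphic to $B/\mathrm{Ann}_n(B)$ for some $n\ge1$. Then the following hold: (1) $A$ is right nilpotent if and only if $B$ is right nilpotent. (2) $A$ is left nilpotent if and only if $B$ is left nilpotent. (3) $A$ is nilpotent if and only if $B$ is nilpotent. (4) $A$ is strongly nilpotent if and only if $B$ is strongly nilpotent. (5) $A$ is $*$-soluble if and only if $B$ is $*$-soluble.
   Context: A skew (left) brace is a set $A$ with two group structures $(A,\cdot)$, $(A,\circ)$ such that $a\circ(b\cdot c)=(a\circ b)\cdot a^{-1}\cdot(a\circ c)$ for all $a,b,c$, where $a^{-1}$ is the inverse in $(A,\cdot)$. The two identities coincide, denoted $1$. Put $\lambda_a(b)=a^{-1}\cdot(a\circ b)$, $a*b=\lambda_a(b)\cdot b^{-1}$, $[a,b]^{\cdot}=a\cdot b\cdot a^{-1}\cdot b^{-1}$. Brace homomorphisms preserve both operations. $\langle S\rangle^{\cdot}$ is the subgroup of $(A,\cdot)$ generated by $S$, and $I*J=\langle x*y: x\in I,y\in J\rangle^{\cdot}$. Annihilator series: $\mathrm{Ann}_0(A)=1$, $\mathrm{Ann}(A)=\mathrm{Ann}_1(A)=\{a: a*b=b*a=[a,b]^{\cdot}=1\ \forall b\in A\}$, $\mathrm{Ann}_n(A)/\mathrm{Ann}_{n-1}(A)=\mathrm{Ann}(A/\mathrm{Ann}_{n-1}(A))$; these are ideals of $A$ (subgroups of $(A,\cdot)$ stable under all $\lambda_a$ and normal in both groups). Define $A^1=A^{(1)}=A^{[1]}=A_1=A$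 and, for $k\ge2$, $A^k=A*A^{k-1}$, $A^{(k)}=A^{(k-1)}*A$, $A^{[k]}=\langle\bigcup_{i=1}^{k-1}A^{[i]}*A^{[k-i]}\rangle^{\cdot}$, $A_k=A_{k-1}*A_{k-1}$. The skew brace $A$ is left nilpotent if $A^k=1$ for some $k\geq 1$, right nilpotent if $A^{(k)}=1$ for some $k\geq 1$, strongly nilpotent if $A^{[k]}=1$ for some $k\geq 1$, $*$-soluble if $A_k=1$ for some $k\geq 1$, and nilpotent if $\mathrm{Ann}_k(A)=A$ for some $k$. *)

theory Defs
  imports "HOL-Algebra.Algebra"
begin

text \<open>
  A brace structure extends the monoid record, so that \<open>A\<close> itself is the group
  \<open>(A, \<cdot>)\<close>. There is only one identity field: the identities of the two groups of a skew
  brace always coincide.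
\<close>

record 'a brace_rec = "'a monoid" +
  circ :: "['a, 'a] \<Rightarrow> 'a" (infixl "\<diamondop>\<index>" 70)

definition circ_group :: "('a, 'b) brace_rec_scheme \<Rightarrow> 'a monoid" where
  "circ_group A = \<lparr>carrier = carrier A, monoid.mult = circ A, one = one A\<rparr>"

locale skew_brace = group A for A :: "('a, 'b) brace_rec_scheme" (structure) +
  assumes circ_is_group: "group (circ_group A)"
    and circ_mult: "\<lbrakk>a \<in> carrier A; b \<in> carrier A; c \<in> carrier A\<rbrakk>
      \<Longrightarrow> a \<diamondop> (b \<otimes> c) = (a \<diamondop> b) \<otimes> inv a \<otimes> (a \<diamondop> c)"

definition lam :: "('a, 'b) brace_rec_scheme \<Rightarrow> 'a \<Rightarrow> 'a \<Rightarrow> 'a" where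
  "lam A a b = inv\<^bsub>A\<^esub> a \<otimes>\<^bsub>A\<^esub> (a \<diamondop>\<^bsub>A\<^esub> b)"

definition star :: "('a, 'b) brace_rec_scheme \<Rightarrow> 'a \<Rightarrow> 'a \<Rightarrow> 'a" where
  "star A a b = lam A a b \<otimes>\<^bsub>A\<^esub> inv\<^bsub>A\<^esub> b"

definition comm :: "('a, 'b) monoid_scheme \<Rightarrow> 'a \<Rightarrow> 'a \<Rightarrow> 'a" where
  "comm G a b = a \<otimes>\<^bsub>G\<^esub> b \<otimes>\<^bsub>G\<^esub> inv\<^bsub>G\<^esub> a \<otimes>\<^bsub>G\<^esub> inv\<^bsub>G\<^esub> b"

definition star_set :: "('a, 'b) brace_rec_scheme \<Rightarrow> 'a set \<Rightarrow> 'a set \<Rightarrow> 'a set" where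
  "star_set A I J = generate A {star A x y | x y. x \<in> I \<and> y \<in> J}"

text \<open>
  The quotient by an ideal \<open>I\<close>, built like \<open>A Mod I\<close>. The cosets of an ideal in the two
  groups coincide, so the complex product for \<open>\<diamondop>\<close> of two such cosets is again one.
\<close>

definition brace_quot :: "('a, 'b) brace_rec_scheme \<Rightarrow> 'a set \<Rightarrow> 'a set brace_rec" where
  "brace_quot A I =
     \<lparr>carrier = rcosets\<^bsub>A\<^esub> I, monoid.mult = set_mult A, one = I, circ = set_mult (circ_group A)\<rparr>"

definition brace_iso ::
  "('a, 'c) brace_rec_scheme \<Rightarrow> ('b, 'd) brace_rec_scheme \<Rightarrow> ('a \<Rightarrow> 'b) set" where
  "brace_iso A B = iso A B \<inter> iso (circ_group A) (circ_group B)"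

definition brace_isomorphic ::
  "('a, 'c) brace_rec_scheme \<Rightarrow> ('b, 'd) brace_rec_scheme \<Rightarrow> bool" where
  "brace_isomorphic A B \<longleftrightarrow> brace_iso A B \<noteq> {}"

definition annihilator :: "('a, 'b) brace_rec_scheme \<Rightarrow> 'a set" where
  "annihilator A = {a \<in> carrier A. \<forall>b \<in> carrier A.
     star A a b = \<one>\<^bsub>A\<^esub> \<and> star A b a = \<one>\<^bsub>A\<^esub> \<and> comm A a b = \<one>\<^bsub>A\<^esub>}"

text \<open>
  The next term is the preimage, under the projection, of the annihilator of the quotient
  by the current term.
\<close>

primrec ann_series :: "('a, 'b) brace_rec_scheme \<Rightarrow> nat \<Rightarrow> 'a set" where
  "ann_series A 0 = {\<one>\<^bsub>A\<^esub>}"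
| "ann_series A (Suc n) = {a \<in> carrier A.
     ann_series A n #>\<^bsub>A\<^esub> a \<in> annihilator (brace_quot A (ann_series A n))}"

text \<open>The four series below start at index 1; the value at index 0 is a dummy.\<close>

fun left_series :: "('a, 'b) brace_rec_scheme \<Rightarrow> nat \<Rightarrow> 'a set" where
  "left_series A 0 = carrier A"
| "left_series A (Suc 0) = carrier A"
| "left_series A (Suc (Suc k)) = star_set A (carrier A) (left_series A (Suc k))"

fun right_series :: "('a, 'b) brace_rec_scheme \<Rightarrow> nat \<Rightarrow> 'a set" where
  "right_series A 0 = carrier A"
| "right_series A (Suc 0) = carrier A"
| "right_series A (Suc (Suc k)) = star_set A (right_series A (Suc k)) (carrier A)"

function strong_series :: "('a, 'b) brace_rec_scheme \<Rightarrow> nat \<Rightarrow> 'a set" where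
  "strong_series A k = (if k \<le> 1 then carrier A
     else generate A (\<Union>i\<in>{1..k - 1}. star_set A (strong_series A i) (strong_series A (k - i))))"
  by auto
termination
  by (relation "measure snd") auto

declare strong_series.simps [simp del]

fun star_derived_series :: "('a, 'b) brace_rec_scheme \<Rightarrow> nat \<Rightarrow> 'a set" where
  "star_derived_series A 0 = carrier A"
| "star_derived_series A (Suc 0) = carrier A"
| "star_derived_series A (Suc (Suc k)) =
     star_set A (star_derived_series A (Suc k)) (star_derived_series A (Suc k))"

definition left_nilpotent :: "('a, 'b) brace_rec_scheme \<Rightarrow> bool" where
  "left_nilpotent A \<longleftrightarrow> (\<exists>k\<ge>1. left_series A k = {\<one>\<^bsub>A\<^esub>})"

definition right_nilpotent :: "('a, 'b) brace_rec_scheme \<Rightarrow> bool" where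
  "right_nilpotent A \<longleftrightarrow> (\<exists>k\<ge>1. right_series A k = {\<one>\<^bsub>A\<^esub>})"

definition strongly_nilpotent :: "('a, 'b) brace_rec_scheme \<Rightarrow> bool" where
  "strongly_nilpotent A \<longleftrightarrow> (\<exists>k\<ge>1. strong_series A k = {\<one>\<^bsub>A\<^esub>})"

definition star_soluble :: "('a, 'b) brace_rec_scheme \<Rightarrow> bool" where
  "star_soluble A \<longleftrightarrow> (\<exists>k\<ge>1. star_derived_series A k = {\<one>\<^bsub>A\<^esub>})"

definition nilpotent_brace :: "('a, 'b) brace_rec_scheme \<Rightarrow> bool" where
  "nilpotent_brace A \<longleftrightarrow> (\<exists>k. ann_series A k = carrier A)"

end

theory Submission
  imports Defs
begin

text \<open>
  Write \<open>Z n\<close> for the \<open>n\<close>-th term of the annihilator series of \<open>A\<close>. All five properties are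
  compared with those of the quotient \<open>A / Z n\<close>, which \<open>A\<close> and \<open>B\<close> share up to isomorphism;
  so it suffices that \<open>A\<close> has a property if and only if \<open>Q\<close> has it, for every epimorphism
  \<open>f\<close> of \<open>A\<close> onto some \<open>Q\<close> with kernel \<open>Z n\<close> (lemma \<open>properties_iff\<close>). This is applied to the
  projection of \<open>B\<close>, and to the projection of \<open>A\<close> followed by the given isomorphism, so that
  both have the same target.

  The arguments rest on one description of the annihilator series by elements
  (\<open>ann_series_Suc_iff\<close>): \<open>a\<close> lies in \<open>Z (n + 1)\<close> if and only if \<open>a * b\<close>, \<open>b * a\<close> and \<open>[a, b]\<close> lie
  in \<open>Z n\<close> for all \<open>b\<close>. Extracting it from the definition requires that the \<open>Z n\<close> are
  ideals, which holds because annihilators are ideals and preimages of ideals are ideals.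

  The terms of the four series built from \<open>*\<close> are mapped by \<open>f\<close> onto the corresponding terms
  for \<open>Q\<close>. So if a series of \<open>Q\<close> reaches \<open>1\<close>, then the series of \<open>A\<close> reaches \<open>Z n\<close>. From
  there it descends to \<open>1\<close>, because a \<open>*\<close>-product with one factor in \<open>Z (m + 1)\<close> lies in
  \<open>Z m\<close>. The left, right and derived series need one step for each such descent. A term of the
  strong series involves factors \<open>i\<close> and \<open>k - i\<close>, one of which is large when \<open>k\<close> is; here the
  index is doubled, and one uses that this series is decreasing. Finally, nilpotency
  passes between \<open>A\<close> and \<open>Q\<close> because \<open>Z (n + m)\<close> is the preimage of the \<open>m\<close>-th annihilator
  term of \<open>Q\<close>.
\<close>

section \<open>Preimages and cosets in groups\<close>

lemma (in group_hom) normal_preimage: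
  assumes "N \<lhd> H"
  shows "{x \<in> carrier G. h x \<in> N} \<lhd> G"
proof -
  interpret N: normal N H by fact
  show ?thesis
  proof (rule G.normal_invI)
    show "subgroup {x \<in> carrier G. h x \<in> N} G"
      by (rule G.subgroupI) (auto intro: exI[of _ "\<one>\<^bsub>G\<^esub>"])
    show "x \<otimes> y \<otimes> inv x \<in> {x \<in> carrier G. h x \<in> N}"
      if "x \<in> carrier G" "y \<in> {x \<in> carrier G. h x \<in> N}" for x y
      using that by (auto intro: N.inv_op_closed2)
  qed
qed

lemma (in group_hom) r_coset_preimage:
  assumes "N \<subseteq> carrier H" "a \<in> carrier G"
  shows "{x \<in> carrier G. h x \<in> N} #>\<^bsub>G\<^esub> a = {x \<in> carrier G. h x \<in> N #>\<^bsub>H\<^esub> h a}"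
proof (intro Set.set_eqI iffI)
  fix x assume "x \<in> {x \<in> carrier G. h x \<in> N} #>\<^bsub>G\<^esub> a"
  then show "x \<in> {x \<in> carrier G. h x \<in> N #>\<^bsub>H\<^esub> h a}"
    using assms by (auto simp: r_coset_def)
next
  fix x assume "x \<in> {x \<in> carrier G. h x \<in> N #>\<^bsub>H\<^esub> h a}"
  then obtain y where x: "x \<in> carrier G" and y: "y \<in> N" "h x = y \<otimes>\<^bsub>H\<^esub> h a"
    by (auto simp: r_coset_def)
  have "h (x \<otimes>\<^bsub>G\<^esub> inv\<^bsub>G\<^esub> a) = y"
    using x y assms by (simp add: H.m_assoc subset_iff)
  moreover have "x = (x \<otimes>\<^bsub>G\<^esub> inv\<^bsub>G\<^esub> a) \<otimes>\<^bsub>G\<^esub> a"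
    using x assms by (simp add: G.m_assoc)
  moreover have "x \<otimes>\<^bsub>G\<^esub> inv\<^bsub>G\<^esub> a \<in> carrier G"
    using x assms by simp
  ultimately show "x \<in> {x \<in> carrier G. h x \<in> N} #>\<^bsub>G\<^esub> a"
    unfolding r_coset_def using y(1) by auto
qed

lemma (in group) comm_eq_one_iff:
  assumes "a \<in> carrier G" "b \<in> carrier G"
  shows "comm G a b = \<one> \<longleftrightarrow> a \<otimes> b = b \<otimes> a"
proof -
  have "comm G a b = (a \<otimes> b) \<otimes> inv (b \<otimes> a)"
    using assms by (simp add: comm_def m_assoc inv_mult_group)
  then show ?thesis
    using assms by (metis inv_closed inv_equality inv_inv m_closed r_inv)
qed

section \<open>Two groups with a common identity\<close>

text \<open>
  The part of the structure of a skew brace that the annihilator series and the four series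
  depend on. It passes to quotients by ideals by the theory of quotient groups, applied to each
  of the two operations.
\<close>

locale bigroup = group A for A :: "('a, 'b) brace_rec_scheme" (structure) +
  assumes circ_is_group: "group (circ_group A)"

lemma skew_brace_imp_bigroup: "skew_brace A \<Longrightarrow> bigroup A"
  by (simp add: skew_brace_def skew_brace_axioms_def bigroup_def bigroup_axioms_def)

lemma circ_group_simps [simp]:
  "carrier (circ_group A) = carrier A"
  "monoid.mult (circ_group A) = circ A"
  "one (circ_group A) = one A"
  by (simp_all add: circ_group_def)

text \<open>
  The coincidence of the cosets takes the place of stability under all \<open>\<lambda>\<close>-maps; in this form
  the definition only speaks of the two groups.
\<close>

definition brace_ideal :: "('a, 'b) brace_rec_scheme \<Rightarrow> 'a set \<Rightarrow> bool" where
  "brace_ideal A I \<longleftrightarrow> I \<lhd> A \<and> I \<lhd> circ_group A \<and>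
     (\<forall>a \<in> carrier A. I #>\<^bsub>A\<^esub> a = I #>\<^bsub>circ_group A\<^esub> a)"

context bigroup
begin

sublocale rnd: group "circ_group A"
  by (rule circ_is_group)

lemma circ_closed [simp]: "a \<in> carrier A \<Longrightarrow> b \<in> carrier A \<Longrightarrow> a \<diamondop> b \<in> carrier A"
  using rnd.m_closed by simp

lemma circ_one [simp]:
  "a \<in> carrier A \<Longrightarrow> a \<diamondop> \<one> = a" "a \<in> carrier A \<Longrightarrow> \<one> \<diamondop> a = a"
  using rnd.r_one rnd.l_one by simp_all

lemma circ_assoc:
  "a \<in> carrier A \<Longrightarrow> b \<in> carrier A \<Longrightarrow> c \<in> carrier A \<Longrightarrow> (a \<diamondop> b) \<diamondop> c = a \<diamondop> (b \<diamondop> c)"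
  using rnd.m_assoc by simp

lemma star_closed [simp]: "a \<in> carrier A \<Longrightarrow> b \<in> carrier A \<Longrightarrow> star A a b \<in> carrier A"
  by (simp add: star_def lam_def)

lemma comm_closed [simp]: "a \<in> carrier A \<Longrightarrow> b \<in> carrier A \<Longrightarrow> comm A a b \<in> carrier A"
  by (simp add: comm_def)

lemma star_eq_one_iff:
  assumes "a \<in> carrier A" "b \<in> carrier A"
  shows "star A a b = \<one> \<longleftrightarrow> a \<diamondop> b = a \<otimes> b"
proof -
  have "star A a b = \<one> \<longleftrightarrow> inv a \<otimes> (a \<diamondop> b) = b"
    unfolding star_def lam_def using assms
    by (metis circ_closed inv_closed inv_equality inv_inv m_closed r_inv)
  also have "\<dots> \<longleftrightarrow> a \<diamondop> b = a \<otimes> b"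
    using assms by (metis circ_closed inv_closed inv_solve_left)
  finally show ?thesis .
qed

lemma annihilator_iff:
  "a \<in> annihilator A \<longleftrightarrow>
     a \<in> carrier A \<and> (\<forall>b \<in> carrier A. a \<diamondop> b = a \<otimes> b \<and> b \<diamondop> a = b \<otimes> a \<and> a \<otimes> b = b \<otimes> a)"
  unfolding annihilator_def by (auto simp: star_eq_one_iff comm_eq_one_iff)

lemma annihilatorD:
  assumes "a \<in> annihilator A"
  shows "a \<in> carrier A"
    and "b \<in> carrier A \<Longrightarrow> a \<diamondop> b = a \<otimes> b"
    and "b \<in> carrier A \<Longrightarrow> b \<diamondop> a = b \<otimes> a"
    and "b \<in> carrier A \<Longrightarrow> a \<otimes> b = b \<otimes> a"
  using assms unfolding annihilator_iff by blast+

lemma annihilator_mult_closed: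
  assumes a: "a \<in> annihilator A" and c: "c \<in> annihilator A"
  shows "a \<otimes> c \<in> annihilator A"
proof -
  have A: "a \<in> carrier A" and C: "c \<in> carrier A"
    using a c by (simp_all add: annihilatorD)
  have aD: "a \<diamondop> b = a \<otimes> b" "b \<diamondop> a = b \<otimes> a" "a \<otimes> b = b \<otimes> a"
    and cD: "c \<diamondop> b = c \<otimes> b" "b \<diamondop> c = b \<otimes> c" "c \<otimes> b = b \<otimes> c" if "b \<in> carrier A" for b
    using annihilatorD(2-4)[OF a that] annihilatorD(2-4)[OF c that] by blast+
  have "(a \<otimes> c) \<diamondop> b = (a \<otimes> c) \<otimes> b" if b: "b \<in> carrier A" for b
  proof -
    have "(a \<otimes> c) \<diamondop> b = (a \<diamondop> c) \<diamondop> b"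
      by (simp add: aD C)
    also have "\<dots> = a \<diamondop> (c \<diamondop> b)"
      using A C b by (rule circ_assoc)
    also have "\<dots> = (a \<otimes> c) \<otimes> b"
      using A C b by (simp add: cD(1) aD(1) m_assoc)
    finally show ?thesis .
  qed
  moreover have "b \<diamondop> (a \<otimes> c) = b \<otimes> (a \<otimes> c)" if b: "b \<in> carrier A" for b
  proof -
    have "b \<diamondop> (a \<otimes> c) = b \<diamondop> (a \<diamondop> c)"
      by (simp add: aD C)
    also have "\<dots> = (b \<diamondop> a) \<diamondop> c"
      using A C b by (simp add: circ_assoc)
    also have "\<dots> = b \<otimes> (a \<otimes> c)"
      using A C b by (simp add: cD(2) aD(2) m_assoc)
    finally show ?thesis .
  qed
  moreover have "(a \<otimes> c) \<otimes> b = b \<otimes> (a \<otimes> c)" if b: "b \<in> carrier A" for b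
    using A C b aD(3)[OF b] cD(3)[OF b] by (metis m_assoc)
  ultimately show ?thesis
    using A C by (simp add: annihilator_iff)
qed

lemma annihilator_inv_closed:
  assumes a: "a \<in> annihilator A"
  shows "inv a \<in> annihilator A"
proof -
  have A: "a \<in> carrier A"
    using a by (rule annihilatorD)
  have aD: "a \<diamondop> b = a \<otimes> b" "b \<diamondop> a = b \<otimes> a" "a \<otimes> b = b \<otimes> a" if "b \<in> carrier A" for b
    using annihilatorD(2-4)[OF a that] by blast+
  \<comment> \<open>The inverses of \<open>a\<close> in the two groups coincide, as \<open>a\<close> multiplies alike in both.\<close>
  have i: "inv a \<diamondop> a = \<one>" "a \<diamondop> inv a = \<one>"
    using A by (simp_all add: aD)
  have "inv a \<diamondop> b = inv a \<otimes> b" if b: "b \<in> carrier A" for b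
  proof -
    have "b = a \<diamondop> (inv a \<otimes> b)"
      using A b by (simp add: aD(1) m_assoc[symmetric])
    then have "inv a \<diamondop> b = (inv a \<diamondop> a) \<diamondop> (inv a \<otimes> b)"
      using A b by (metis circ_assoc inv_closed m_closed)
    then show ?thesis
      using A b by (simp add: i)
  qed
  moreover have "b \<diamondop> inv a = b \<otimes> inv a" if b: "b \<in> carrier A" for b
  proof -
    have "b = (b \<otimes> inv a) \<diamondop> a"
      using A b by (simp add: aD(2) m_assoc)
    then have "b \<diamondop> inv a = (b \<otimes> inv a) \<diamondop> (a \<diamondop> inv a)"
      using A b by (metis circ_assoc inv_closed m_closed)
    then show ?thesis
      using A b by (simp add: i)
  qed
  moreover have "inv a \<otimes> b = b \<otimes> inv a" if b: "b \<in> carrier A" for b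
    using A b aD(3)[OF b] by (metis inv_closed inv_solve_left inv_solve_right m_assoc m_closed)
  ultimately show ?thesis
    using A by (simp add: annihilator_iff)
qed

text \<open>
  On annihilator elements both operations agree and are central, so the subgroup and coset
  conditions for \<open>\<diamondop>\<close> are those for \<open>\<otimes>\<close>.
\<close>

lemma annihilator_ideal: "brace_ideal A (annihilator A)"
proof -
  let ?Z = "annihilator A"
  have sub: "?Z \<subseteq> carrier A"
    by (auto simp: annihilator_iff)
  have one: "\<one> \<in> ?Z"
    by (simp add: annihilator_iff)
  have rinv: "inv\<^bsub>circ_group A\<^esub> a = inv a" if "a \<in> ?Z" for a
  proof -
    have a: "a \<in> carrier A"
      using that by (rule annihilatorD)
    then have "inv a \<diamondop> a = \<one>"
      using annihilatorD(3)[OF that, of "inv a"] by simp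
    then show ?thesis
      using a rnd.inv_equality[of "inv a" a] by simp
  qed
  have "?Z \<lhd> A"
  proof (rule normal_invI)
    show "subgroup ?Z A"
      using sub one by (intro subgroupI) (auto intro: annihilator_mult_closed annihilator_inv_closed)
    show "x \<otimes> h \<otimes> inv x \<in> ?Z" if "x \<in> carrier A" "h \<in> ?Z" for x h
    proof -
      have "x \<otimes> h \<otimes> inv x = h"
        using that by (metis annihilator_iff inv_solve_right m_closed)
      with that show ?thesis by simp
    qed
  qed
  moreover have "?Z \<lhd> circ_group A"
  proof (rule rnd.normal_invI)
    show "subgroup ?Z (circ_group A)"
    proof (rule rnd.subgroupI)
      show "a \<otimes>\<^bsub>circ_group A\<^esub> b \<in> ?Z" if "a \<in> ?Z" "b \<in> ?Z" for a b
        using annihilator_mult_closed[OF that] annihilatorD(1,2)[OF that(1)] annihilatorD(1)[OF that(2)]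
        by simp
      show "inv\<^bsub>circ_group A\<^esub> a \<in> ?Z" if "a \<in> ?Z" for a
        using that by (simp add: rinv annihilator_inv_closed)
    qed (use sub one in auto)
    show "x \<otimes>\<^bsub>circ_group A\<^esub> h \<otimes>\<^bsub>circ_group A\<^esub> inv\<^bsub>circ_group A\<^esub> x \<in> ?Z"
      if "x \<in> carrier (circ_group A)" "h \<in> ?Z" for x h
    proof -
      have "x \<diamondop> h = h \<diamondop> x" "h \<in> carrier A"
        using that annihilatorD[of h] by simp_all
      then have "x \<otimes>\<^bsub>circ_group A\<^esub> h \<otimes>\<^bsub>circ_group A\<^esub> inv\<^bsub>circ_group A\<^esub> x = h"
        using that rnd.m_assoc[of h x "inv\<^bsub>circ_group A\<^esub> x"] rnd.r_inv[of x] rnd.inv_closed[of x]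
        by simp
      with that show ?thesis by simp
    qed
  qed
  moreover have "?Z #>\<^bsub>A\<^esub> a = ?Z #>\<^bsub>circ_group A\<^esub> a" if "a \<in> carrier A" for a
    unfolding r_coset_def using that by (simp add: annihilatorD)
  ultimately show ?thesis
    by (simp add: brace_ideal_def)
qed

lemma trivial_ideal: "brace_ideal A {\<one>}"
  using one_is_normal rnd.one_is_normal by (simp add: brace_ideal_def r_coset_def)

lemma star_set_carrier:
  assumes "I \<subseteq> carrier A" "J \<subseteq> carrier A"
  shows "star_set A I J \<subseteq> carrier A"
  unfolding star_set_def by (rule generate_incl) (use assms in \<open>blast intro: star_closed\<close>)

lemma star_set_mono:
  assumes "I \<subseteq> I'" "J \<subseteq> J'"
  shows "star_set A I J \<subseteq> star_set A I' J'"
  unfolding star_set_def by (rule mono_generate) (use assms in blast)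

lemma one_in_star_set: "\<one> \<in> star_set A I J"
  unfolding star_set_def by (rule generate.one)

lemma star_set_leI:
  assumes "subgroup H A" "\<And>x y. x \<in> I \<Longrightarrow> y \<in> J \<Longrightarrow> star A x y \<in> H"
  shows "star_set A I J \<subseteq> H"
  unfolding star_set_def by (rule generate_subgroup_incl) (use assms in auto)

end

section \<open>Epimorphisms\<close>

locale brace_epi = A: bigroup A + Q: bigroup Q
  for A :: "('a, 'c) brace_rec_scheme" and Q :: "('b, 'd) brace_rec_scheme" and f :: "'a \<Rightarrow> 'b" +
  assumes hom_mult: "f \<in> hom A Q"
    and hom_circ: "f \<in> hom (circ_group A) (circ_group Q)"
    and surj: "f ` carrier A = carrier Q"
begin

sublocale dot: group_hom A Q f
  by unfold_locales (rule hom_mult)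

sublocale rnd: group_hom "circ_group A" "circ_group Q" f
  by unfold_locales (rule hom_circ)

lemma map_circ:
  "a \<in> carrier A \<Longrightarrow> b \<in> carrier A \<Longrightarrow> f (a \<diamondop>\<^bsub>A\<^esub> b) = f a \<diamondop>\<^bsub>Q\<^esub> f b"
  using rnd.hom_mult by simp

lemma map_star:
  "a \<in> carrier A \<Longrightarrow> b \<in> carrier A \<Longrightarrow> f (star A a b) = star Q (f a) (f b)"
  by (simp add: star_def lam_def map_circ)

lemma map_comm:
  "a \<in> carrier A \<Longrightarrow> b \<in> carrier A \<Longrightarrow> f (comm A a b) = comm Q (f a) (f b)"
  by (simp add: comm_def)

lemma map_annihilator_iff:
  assumes "a \<in> carrier A"
  shows "f a \<in> annihilator Q \<longleftrightarrow> (\<forall>b \<in> carrier A. f (star A a b) = \<one>\<^bsub>Q\<^esub> \<and>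
    f (star A b a) = \<one>\<^bsub>Q\<^esub> \<and> f (comm A a b) = \<one>\<^bsub>Q\<^esub>)"
  unfolding annihilator_def surj[symmetric] using assms by (simp add: map_star map_comm)

lemma ideal_preimage:
  assumes "brace_ideal Q J"
  shows "brace_ideal A {x \<in> carrier A. f x \<in> J}"
proof -
  have J: "J \<lhd> Q" "J \<lhd> circ_group Q" and
    cosets: "\<And>q. q \<in> carrier Q \<Longrightarrow> J #>\<^bsub>Q\<^esub> q = J #>\<^bsub>circ_group Q\<^esub> q"
    using assms by (auto simp: brace_ideal_def)
  have sub: "J \<subseteq> carrier Q"
    using J(1) by (simp add: normal_imp_subgroup subgroup.subset)
  show ?thesis
    using dot.normal_preimage[OF J(1)] rnd.normal_preimage[OF J(2)]
      dot.r_coset_preimage[OF sub] rnd.r_coset_preimage[of J] sub cosets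
    by (simp add: brace_ideal_def)
qed

lemma map_star_set:
  assumes "I \<subseteq> carrier A" "J \<subseteq> carrier A"
  shows "f ` star_set A I J = star_set Q (f ` I) (f ` J)"
proof -
  have img: "f ` {star A x y | x y. x \<in> I \<and> y \<in> J} = {star Q x y | x y. x \<in> f ` I \<and> y \<in> f ` J}"
    (is "f ` ?S = ?T")
  proof (intro Set.set_eqI iffI)
    fix z assume "z \<in> f ` ?S"
    then obtain x y where "x \<in> I" "y \<in> J" "z = f (star A x y)" by auto
    moreover from this have "z = star Q (f x) (f y)"
      using assms by (metis map_star subsetD)
    ultimately show "z \<in> ?T" by blast
  next
    fix z assume "z \<in> ?T"
    then obtain x y where "x \<in> I" "y \<in> J" "z = star Q (f x) (f y)" by auto
    moreover from this have "z = f (star A x y)"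
      using assms by (metis map_star subsetD)
    ultimately show "z \<in> f ` ?S" by blast
  qed
  have "?S \<subseteq> carrier A"
    using assms by (blast intro: A.star_closed)
  then show ?thesis
    unfolding star_set_def img[symmetric] by (rule dot.generate_img[symmetric])
qed

end

section \<open>Quotients and the annihilator series\<close>

declare ann_series.simps(2) [simp del]

context bigroup
begin

text \<open>
  Since the cosets of \<open>I\<close> in the two groups are the same sets, both operations of the quotient are
  those of ordinary factor groups on a common carrier.
\<close>

lemma quotient_epi:
  assumes "brace_ideal A I"
  shows "brace_epi A (brace_quot A I) (\<lambda>a. I #>\<^bsub>A\<^esub> a)"
proof -
  have I: "I \<lhd> A" "I \<lhd> circ_group A" and
    cosets: "\<And>a. a \<in> carrier A \<Longrightarrow> I #>\<^bsub>A\<^esub> a = I #>\<^bsub>circ_group A\<^esub> a"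
    using assms by (auto simp: brace_ideal_def)
  have rc: "rcosets\<^bsub>circ_group A\<^esub> I = rcosets\<^bsub>A\<^esub> I"
    unfolding RCOSETS_def using cosets by simp
  have circ: "circ_group (brace_quot A I) = circ_group A Mod I"
    by (simp add: brace_quot_def FactGroup_def circ_group_def[of "brace_quot _ _"] rc
        circ_group_def[of "\<lparr>carrier = _, monoid.mult = _, one = _, circ = _\<rparr>"])
  have g: "group (brace_quot A I)"
    using normal.factorgroup_is_group[OF I(1)]
    by (simp add: brace_quot_def FactGroup_def group_def group_axioms_def monoid_def Units_def)
  show ?thesis
  proof (intro brace_epi.intro brace_epi_axioms.intro bigroup.intro bigroup_axioms.intro)
    show "group (circ_group (brace_quot A I))"
      unfolding circ by (rule normal.factorgroup_is_group[OF I(2)])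
    show "(\<lambda>a. I #>\<^bsub>A\<^esub> a) \<in> hom A (brace_quot A I)"
      using normal.r_coset_hom_Mod[OF I(1)] by (simp add: hom_def brace_quot_def FactGroup_def)
    show "(\<lambda>a. I #>\<^bsub>A\<^esub> a) \<in> hom (circ_group A) (circ_group (brace_quot A I))"
      unfolding circ using normal.r_coset_hom_Mod[OF I(2)] by (auto simp: hom_def cosets Pi_iff)
    show "(\<lambda>a. I #>\<^bsub>A\<^esub> a) ` carrier A = carrier (brace_quot A I)"
      by (auto simp: brace_quot_def RCOSETS_def)
  qed (use g in \<open>auto intro: is_group circ_is_group\<close>)
qed

lemma quotient_map_eq_one_iff:
  assumes "brace_ideal A I" "a \<in> carrier A"
  shows "I #>\<^bsub>A\<^esub> a = \<one>\<^bsub>brace_quot A I\<^esub> \<longleftrightarrow> a \<in> I"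
proof -
  have "subgroup I A"
    using assms by (simp add: brace_ideal_def normal_imp_subgroup)
  then show ?thesis
    using assms(2) coset_join1[of I a] coset_join2[of a I] subgroup.subset[of I A]
    by (auto simp: brace_quot_def)
qed

lemma ann_series_ideal: "brace_ideal A (ann_series A n)"
proof (induction n)
  case 0
  then show ?case by (simp add: trivial_ideal)
next
  case (Suc n)
  interpret p: brace_epi A "brace_quot A (ann_series A n)" "\<lambda>a. ann_series A n #>\<^bsub>A\<^esub> a"
    by (rule quotient_epi[OF Suc])
  show ?case
    using p.ideal_preimage[OF p.Q.annihilator_ideal] by (simp add: ann_series.simps(2))
qed

lemma ann_series_subgroup: "subgroup (ann_series A n) A"
  using ann_series_ideal by (simp add: brace_ideal_def normal_imp_subgroup)

lemma ann_series_carrier: "ann_series A n \<subseteq> carrier A"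
  using ann_series_subgroup by (rule subgroup.subset)

lemma ann_series_Suc_iff:
  "a \<in> ann_series A (Suc n) \<longleftrightarrow> a \<in> carrier A \<and> (\<forall>b \<in> carrier A. star A a b \<in> ann_series A n \<and>
     star A b a \<in> ann_series A n \<and> comm A a b \<in> ann_series A n)"
proof (cases "a \<in> carrier A")
  case True
  interpret p: brace_epi A "brace_quot A (ann_series A n)" "\<lambda>a. ann_series A n #>\<^bsub>A\<^esub> a"
    by (rule quotient_epi[OF ann_series_ideal])
  show ?thesis
    using True p.map_annihilator_iff[OF True]
    by (simp add: ann_series.simps(2) quotient_map_eq_one_iff[OF ann_series_ideal])
qed (simp add: ann_series.simps(2))

lemma ann_series_stays_carrier:
  assumes "ann_series A k = carrier A"
  shows "ann_series A (k + j) = carrier A"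
proof (induction j)
  case (Suc j)
  then show ?case
    using ann_series_carrier[of "k + Suc j"]
    by (auto simp: ann_series_Suc_iff)
qed (use assms in simp)

section \<open>Descent along the annihilator series\<close>

text \<open>
  Each of the four series built from \<open>*\<close> will be taken for \<open>S\<close>. The second assumption leaves the
  new index free because the strong series descends more slowly than the other three.
\<close>

lemma series_reaches_one:
  assumes one: "\<And>k. \<one> \<in> S k"
    and step: "\<And>k n. k \<ge> 1 \<Longrightarrow> S k \<subseteq> ann_series A (Suc n) \<Longrightarrow> \<exists>k'\<ge>1. S k' \<subseteq> ann_series A n"
    and start: "k \<ge> 1" "S k \<subseteq> ann_series A n"
  shows "\<exists>k\<ge>1. S k = {\<one>}"
  using start
proof (induction n arbitrary: k)
  case 0
  then show ?case using one[of k] by auto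
next
  case (Suc n)
  then show ?case using step by blast
qed

lemma star_set_ann_left:
  assumes "I \<subseteq> ann_series A (Suc n)" "J \<subseteq> carrier A"
  shows "star_set A I J \<subseteq> ann_series A n"
  by (rule star_set_leI[OF ann_series_subgroup])
    (use assms in \<open>auto simp: ann_series_Suc_iff subset_iff\<close>)

lemma star_set_ann_right:
  assumes "I \<subseteq> carrier A" "J \<subseteq> ann_series A (Suc n)"
  shows "star_set A I J \<subseteq> ann_series A n"
  by (rule star_set_leI[OF ann_series_subgroup])
    (use assms in \<open>auto simp: ann_series_Suc_iff subset_iff\<close>)

lemma left_series_carrier: "left_series A k \<subseteq> carrier A"
  by (induction k rule: induct_nat_012) (simp_all add: star_set_carrier)

lemma right_series_carrier: "right_series A k \<subseteq> carrier A"
  by (induction k rule: induct_nat_012) (simp_all add: star_set_carrier)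

lemma star_derived_series_carrier: "star_derived_series A k \<subseteq> carrier A"
  by (induction k rule: induct_nat_012) (simp_all add: star_set_carrier)

lemma strong_series_le_1 [simp]: "k \<le> 1 \<Longrightarrow> strong_series A k = carrier A"
  by (subst strong_series.simps) simp

lemma strong_series_ge_2:
  "k \<ge> 2 \<Longrightarrow> strong_series A k =
     generate A (\<Union>i\<in>{1..k - 1}. star_set A (strong_series A i) (strong_series A (k - i)))"
  by (subst strong_series.simps) simp

lemma strong_series_carrier: "strong_series A k \<subseteq> carrier A"
proof (induction k rule: less_induct)
  case (less k)
  show ?case
  proof (cases "k \<le> 1")
    case False
    then have "(\<Union>i\<in>{1..k - 1}. star_set A (strong_series A i) (strong_series A (k - i))) \<subseteq> carrier A"
      by (intro UN_least star_set_carrier less.IH) auto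
    then show ?thesis
      using False generate_incl by (simp add: strong_series_ge_2)
  qed simp
qed

lemma one_in_series:
  "\<one> \<in> left_series A k" "\<one> \<in> right_series A k" "\<one> \<in> strong_series A k"
  "\<one> \<in> star_derived_series A k"
  subgoal by (cases "(A, k)" rule: left_series.cases) (auto intro: one_in_star_set)
  subgoal by (cases "(A, k)" rule: right_series.cases) (auto intro: one_in_star_set)
  subgoal by (cases "k \<le> 1") (auto simp: strong_series_ge_2 intro: generate.one)
  subgoal by (cases "(A, k)" rule: star_derived_series.cases) (auto intro: one_in_star_set)
  done

text \<open>
  Let \<open>S\<close> be the strong series. Each \<open>S i * S (k + 1 - i)\<close> that generates \<open>S (k + 1)\<close> is contained in
  one of those that generate \<open>S k\<close>: lower the index of the first factor by one, or that of the
  second if the first is already \<open>1\<close>.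
\<close>

lemma strong_series_Suc_subset: "strong_series A (Suc k) \<subseteq> strong_series A k"
proof (induction k rule: less_induct)
  case (less k)
  show ?case
  proof (cases "k \<le> 1")
    case True
    then show ?thesis using strong_series_carrier by simp
  next
    case False
    let ?S = "strong_series A"
    have "star_set A (?S i) (?S (Suc k - i)) \<subseteq>
        (\<Union>i\<in>{1..k - 1}. star_set A (?S i) (?S (k - i)))" if i: "i \<in> {1..k}" for i
    proof (cases "i = 1")
      case True
      have "?S (Suc (k - 1)) \<subseteq> ?S (k - 1)"
        using False by (intro less.IH) auto
      then have "star_set A (?S i) (?S (Suc k - i)) \<subseteq> star_set A (?S 1) (?S (k - 1))"
        using True False by (intro star_set_mono) auto
      then show ?thesis using False by force
    next
      case i1: False
      have "?S (Suc (i - 1)) \<subseteq> ?S (i - 1)"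
        using i i1 by (intro less.IH) auto
      then have "star_set A (?S i) (?S (Suc k - i)) \<subseteq> star_set A (?S (i - 1)) (?S (k - (i - 1)))"
        using i i1 by (intro star_set_mono) (auto simp: Suc_diff_le)
      moreover have "i - 1 \<in> {1..k - 1}"
        using i i1 by auto
      ultimately show ?thesis by blast
    qed
    then have "(\<Union>i\<in>{1..k}. star_set A (?S i) (?S (Suc k - i))) \<subseteq>
        (\<Union>i\<in>{1..k - 1}. star_set A (?S i) (?S (k - i)))"
      by (rule UN_least)
    from mono_generate[OF this] show ?thesis
      using False strong_series_ge_2[of k] strong_series_ge_2[of "Suc k"] by simp
  qed
qed

lemma strong_series_antimono: "i \<le> j \<Longrightarrow> strong_series A j \<subseteq> strong_series A i"
  by (rule lift_Suc_antimono_le[of "strong_series A"]) (rule strong_series_Suc_subset)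

text \<open>If two indices add up to \<open>2 * k\<close>, then one of them is at least \<open>k\<close>.\<close>

lemma strong_series_step:
  assumes "k \<ge> 1" "strong_series A k \<subseteq> ann_series A (Suc n)"
  shows "strong_series A (2 * k) \<subseteq> ann_series A n"
proof -
  let ?S = "strong_series A"
  have "star_set A (?S i) (?S (2 * k - i)) \<subseteq> ann_series A n" for i
  proof (cases "k \<le> i")
    case True
    then have "?S i \<subseteq> ann_series A (Suc n)"
      using strong_series_antimono assms(2) by blast
    then show ?thesis
      by (rule star_set_ann_left[OF _ strong_series_carrier])
  next
    case False
    then have "?S (2 * k - i) \<subseteq> ann_series A (Suc n)"
      by (intro subset_trans[OF strong_series_antimono assms(2)]) simp
    then show ?thesis
      by (rule star_set_ann_right[OF strong_series_carrier])
  qed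
  then show ?thesis
    using assms(1) generate_subgroup_incl[OF _ ann_series_subgroup]
    by (simp add: strong_series_ge_2 UN_least)
qed

end

section \<open>Epimorphisms with kernel in the annihilator series\<close>

context brace_epi
begin

lemma map_left_series: "left_series Q k = f ` left_series A k"
  by (induction k rule: induct_nat_012)
    (simp_all add: surj map_star_set A.left_series_carrier)

lemma map_right_series: "right_series Q k = f ` right_series A k"
  by (induction k rule: induct_nat_012)
    (simp_all add: surj map_star_set A.right_series_carrier)

lemma map_star_derived_series: "star_derived_series Q k = f ` star_derived_series A k"
  by (induction k rule: induct_nat_012)
    (simp_all add: map_star_set A.star_derived_series_carrier surj)

lemma map_strong_series: "strong_series Q k = f ` strong_series A k"
proof (induction k rule: less_induct)
  case (less k)
  show ?case
  proof (cases "k \<le> 1")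
    case True
    then show ?thesis by (simp add: surj)
  next
    case False
    let ?G = "\<lambda>i. star_set A (strong_series A i) (strong_series A (k - i))"
    have "star_set Q (strong_series Q i) (strong_series Q (k - i)) = f ` ?G i"
      if "i \<in> {1..k - 1}" for i
    proof -
      have "i < k" "k - i < k"
        using that False by auto
      then show ?thesis
        by (simp add: less.IH map_star_set A.strong_series_carrier)
    qed
    then have "strong_series Q k = generate Q (f ` (\<Union>i\<in>{1..k - 1}. ?G i))"
      using False by (simp add: Q.strong_series_ge_2 image_UN)
    also have "\<dots> = f ` generate A (\<Union>i\<in>{1..k - 1}. ?G i)"
      by (rule dot.generate_img)
        (intro UN_least A.star_set_carrier A.strong_series_carrier)
    finally show ?thesis
      using False by (simp add: A.strong_series_ge_2)
  qed
qed

text \<open>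
  Here \<open>S\<close> is one of the four series of \<open>A\<close> and \<open>T\<close> the same series of \<open>Q\<close>.
  If \<open>T\<close> reaches \<open>1\<close> then \<open>S\<close> reaches the kernel, which is a term of the annihilator series, and
  goes on to \<open>1\<close> from there.
\<close>

lemma series_reaches_one_iff:
  assumes ker: "\<And>a. a \<in> carrier A \<Longrightarrow> f a = \<one>\<^bsub>Q\<^esub> \<longleftrightarrow> a \<in> ann_series A n"
    and sub: "\<And>k. S k \<subseteq> carrier A"
    and one: "\<And>k. \<one>\<^bsub>A\<^esub> \<in> S k"
    and step: "\<And>k n. k \<ge> 1 \<Longrightarrow> S k \<subseteq> ann_series A (Suc n) \<Longrightarrow> \<exists>k'\<ge>1. S k' \<subseteq> ann_series A n"
    and image: "\<And>k. T k = f ` S k"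
  shows "(\<exists>k\<ge>1. S k = {\<one>\<^bsub>A\<^esub>}) \<longleftrightarrow> (\<exists>k\<ge>1. T k = {\<one>\<^bsub>Q\<^esub>})"
proof
  assume "\<exists>k\<ge>1. S k = {\<one>\<^bsub>A\<^esub>}"
  then obtain k where "k \<ge> 1" "S k = {\<one>\<^bsub>A\<^esub>}" by blast
  then have "T k = {\<one>\<^bsub>Q\<^esub>}"
    by (simp add: image)
  with \<open>k \<ge> 1\<close> show "\<exists>k\<ge>1. T k = {\<one>\<^bsub>Q\<^esub>}" by blast
next
  assume "\<exists>k\<ge>1. T k = {\<one>\<^bsub>Q\<^esub>}"
  then obtain k where k: "k \<ge> 1" "f ` S k = {\<one>\<^bsub>Q\<^esub>}"
    by (auto simp: image)
  then have start: "S k \<subseteq> ann_series A n"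
    using ker sub by blast
  show "\<exists>k\<ge>1. S k = {\<one>\<^bsub>A\<^esub>}"
    by (rule A.series_reaches_one[of S, OF one step k(1) start])
qed

text \<open>
  The description by elements is compatible with \<open>f\<close>, so an induction on \<open>m\<close> starting from the
  kernel applies.
\<close>

lemma ann_series_preimage:
  assumes ker: "\<And>a. a \<in> carrier A \<Longrightarrow> f a = \<one>\<^bsub>Q\<^esub> \<longleftrightarrow> a \<in> ann_series A n"
    and "a \<in> carrier A"
  shows "f a \<in> ann_series Q m \<longleftrightarrow> a \<in> ann_series A (n + m)"
  using assms(2)
proof (induction m arbitrary: a)
  case 0
  then show ?case by (simp add: ker)
next
  case (Suc m)
  have "f a \<in> ann_series Q (Suc m) \<longleftrightarrow> (\<forall>b \<in> carrier A. f (star A a b) \<in> ann_series Q m \<and>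
      f (star A b a) \<in> ann_series Q m \<and> f (comm A a b) \<in> ann_series Q m)"
    unfolding Q.ann_series_Suc_iff surj[symmetric]
    using Suc.prems by (simp add: map_star map_comm)
  also have "\<dots> \<longleftrightarrow> a \<in> ann_series A (Suc (n + m))"
    unfolding A.ann_series_Suc_iff using Suc by simp
  finally show ?case by simp
qed

lemma nilpotent_iff:
  assumes ker: "\<And>a. a \<in> carrier A \<Longrightarrow> f a = \<one>\<^bsub>Q\<^esub> \<longleftrightarrow> a \<in> ann_series A n"
  shows "nilpotent_brace A \<longleftrightarrow> nilpotent_brace Q"
proof -
  have top: "ann_series Q m = carrier Q \<longleftrightarrow> ann_series A (n + m) = carrier A" for m
  proof -
    have "ann_series Q m = carrier Q \<longleftrightarrow> (\<forall>a \<in> carrier A. f a \<in> ann_series Q m)"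
      using Q.ann_series_carrier[of m] unfolding surj[symmetric] by blast
    also have "\<dots> \<longleftrightarrow> (\<forall>a \<in> carrier A. a \<in> ann_series A (n + m))"
      by (simp add: ann_series_preimage[OF ker])
    also have "\<dots> \<longleftrightarrow> ann_series A (n + m) = carrier A"
      using A.ann_series_carrier[of "n + m"] by blast
    finally show ?thesis .
  qed
  show ?thesis
    unfolding nilpotent_brace_def top
    using A.ann_series_stays_carrier by (metis add.commute)
qed

lemma properties_iff:
  assumes ker: "\<And>a. a \<in> carrier A \<Longrightarrow> f a = \<one>\<^bsub>Q\<^esub> \<longleftrightarrow> a \<in> ann_series A n"
  shows "right_nilpotent A \<longleftrightarrow> right_nilpotent Q"
    and "left_nilpotent A \<longleftrightarrow> left_nilpotent Q"
    and "nilpotent_brace A \<longleftrightarrow> nilpotent_brace Q"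
    and "strongly_nilpotent A \<longleftrightarrow> strongly_nilpotent Q"
    and "star_soluble A \<longleftrightarrow> star_soluble Q"
proof -
  show "right_nilpotent A \<longleftrightarrow> right_nilpotent Q"
    unfolding right_nilpotent_def
  proof (rule series_reaches_one_iff[OF ker A.right_series_carrier A.one_in_series(2) _ map_right_series])
    fix k m assume "k \<ge> 1" "right_series A k \<subseteq> ann_series A (Suc m)"
    then have "right_series A (Suc k) \<subseteq> ann_series A m"
      by (cases k) (simp_all add: A.star_set_ann_left)
    then show "\<exists>k'\<ge>1. right_series A k' \<subseteq> ann_series A m"
      by (intro exI[of _ "Suc k"]) simp
  qed
  show "left_nilpotent A \<longleftrightarrow> left_nilpotent Q"
    unfolding left_nilpotent_def
  proof (rule series_reaches_one_iff[OF ker A.left_series_carrier A.one_in_series(1) _ map_left_series])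
    fix k m assume "k \<ge> 1" "left_series A k \<subseteq> ann_series A (Suc m)"
    then have "left_series A (Suc k) \<subseteq> ann_series A m"
      by (cases k) (simp_all add: A.star_set_ann_right)
    then show "\<exists>k'\<ge>1. left_series A k' \<subseteq> ann_series A m"
      by (intro exI[of _ "Suc k"]) simp
  qed
  show "strongly_nilpotent A \<longleftrightarrow> strongly_nilpotent Q"
    unfolding strongly_nilpotent_def
  proof (rule series_reaches_one_iff[OF ker A.strong_series_carrier A.one_in_series(3) _ map_strong_series])
    fix k m assume k: "k \<ge> 1" "strong_series A k \<subseteq> ann_series A (Suc m)"
    then show "\<exists>k'\<ge>1. strong_series A k' \<subseteq> ann_series A m"
      using A.strong_series_step[OF k] by (intro exI[of _ "2 * k"]) simp
  qed
  show "star_soluble A \<longleftrightarrow> star_soluble Q"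
    unfolding star_soluble_def
  proof (rule series_reaches_one_iff[OF ker A.star_derived_series_carrier A.one_in_series(4) _
        map_star_derived_series])
    fix k m assume "k \<ge> 1" "star_derived_series A k \<subseteq> ann_series A (Suc m)"
    then have "star_derived_series A (Suc k) \<subseteq> ann_series A m"
      using A.star_derived_series_carrier
      by (cases k) (simp_all add: A.star_set_ann_left)
    then show "\<exists>k'\<ge>1. star_derived_series A k' \<subseteq> ann_series A m"
      by (intro exI[of _ "Suc k"]) simp
  qed
qed (rule nilpotent_iff[OF ker])

end

theorem proposition7p14:
  fixes A :: "'a brace_rec" and B :: "'b brace_rec" and n :: nat
  assumes "skew_brace A" and "skew_brace B"
    and "n \<ge> 1"
    and "brace_isomorphic (brace_quot A (ann_series A n)) (brace_quot B (ann_series B n))"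
  shows "(right_nilpotent A \<longleftrightarrow> right_nilpotent B) \<and>
    (left_nilpotent A \<longleftrightarrow> left_nilpotent B) \<and>
    (nilpotent_brace A \<longleftrightarrow> nilpotent_brace B) \<and>
    (strongly_nilpotent A \<longleftrightarrow> strongly_nilpotent B) \<and>
    (star_soluble A \<longleftrightarrow> star_soluble B)"
proof -
  interpret A: bigroup A using assms(1) by (rule skew_brace_imp_bigroup)
  interpret B: bigroup B using assms(2) by (rule skew_brace_imp_bigroup)
  let ?QA = "brace_quot A (ann_series A n)" and ?QB = "brace_quot B (ann_series B n)"
  let ?p = "\<lambda>a. ann_series A n #>\<^bsub>A\<^esub> a"
  interpret p: brace_epi A ?QA ?p
    by (rule A.quotient_epi[OF A.ann_series_ideal])
  interpret q: brace_epi B ?QB "\<lambda>b. ann_series B n #>\<^bsub>B\<^esub> b"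
    by (rule B.quotient_epi[OF B.ann_series_ideal])
  obtain h where h: "h \<in> iso ?QA ?QB" "h \<in> iso (circ_group ?QA) (circ_group ?QB)"
    using assms(4) by (auto simp: brace_isomorphic_def brace_iso_def)
  interpret h: group_hom ?QA ?QB h
    using h(1) by unfold_locales (simp add: iso_def)
  have bij: "bij_betw h (carrier ?QA) (carrier ?QB)"
    using h(1) by (simp add: iso_def)
  interpret f: brace_epi A ?QB "h \<circ> ?p"
  proof unfold_locales
    show "h \<circ> ?p \<in> hom A ?QB"
      by (rule hom_compose[OF p.hom_mult iso_imp_homomorphism[OF h(1)]])
    show "h \<circ> ?p \<in> hom (circ_group A) (circ_group ?QB)"
      by (rule hom_compose[OF p.hom_circ iso_imp_homomorphism[OF h(2)]])
    show "(h \<circ> ?p) ` carrier A = carrier ?QB"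
      using bij p.surj by (metis bij_betw_imp_surj_on image_comp)
  qed
  have kerA: "(h \<circ> ?p) a = \<one>\<^bsub>?QB\<^esub> \<longleftrightarrow> a \<in> ann_series A n" if a: "a \<in> carrier A" for a
  proof -
    have "?p a \<in> carrier ?QA"
      using a by (rule p.dot.hom_closed)
    then have "h (?p a) = \<one>\<^bsub>?QB\<^esub> \<longleftrightarrow> ?p a = \<one>\<^bsub>?QA\<^esub>"
      using bij h.hom_one p.Q.one_closed by (metis bij_betw_imp_inj_on inj_onD)
    then show ?thesis
      using A.quotient_map_eq_one_iff[OF A.ann_series_ideal a] by simp
  qed
  show ?thesis
    using f.properties_iff[OF kerA] q.properties_iff[OF B.quotient_map_eq_one_iff[OF B.ann_series_ideal]]
    by simp
qed

end
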